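(* There is an absolute constant $C>0$ such that the following holds. Let $D\ge 1$, let $P\subset\mathbb{R}^D$ be a set of $N\ge 2$ points, let $\epsilon\in(0,1)$ and $c>0$, and let $$k=\left\lceil\frac{4\ln(N^{c+2})}{\epsilon^2}\left(C+\frac{8}{\pi}\big(1-\ln(\epsilon^2/3)\big)\right)\right\rceil.$$ Let $F:\mathbb{R}^D\to\mathbb{R}^k$ be the random linear map whose matrix entries are i.i.d. standard Cauchy random variables. Then, with probability at least $1-N^{-c}$, the bound $$(1-\epsilon)\,\mu\big(\|x-y\|_1\big)\leq \rho\big(F(x),F(y)\big)\leq (1+\epsilon)\,\mu\big(\|x-y\|_1\big)$$ holds simultaneously for all $x,y\in P$ with $\|x-y\|_1\in[\epsilon^2/3,\sqrt{1+\epsilon}]$.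
   Context: $\mathrm{Cauchy}(1)$ is the standard Cauchy distribution on $\mathbb{R}$, with density $\frac{1}{\pi(1+x^2)}$. For $\lambda\ge 0$ define $\xi(\lambda):=\ln(1+\sqrt{\lambda})+\frac12\ln(1+\lambda)$ and $\mu(\lambda):=\mathbb{E}\,\xi(\lambda|X|)$ with $X\sim\mathrm{Cauchy}(1)$. For $u,v\in\mathbb{R}^k$ define the metric $\rho(u,v):=\frac1k\sum_{i=1}^k\xi(|u_i-v_i|)$. $\|\cdot\|_1$ is the 1-norm on $\mathbb{R}^D$. *)

theory Defs
  imports "HOL-Probability.Probability"
begin

text \<open>
  Dimensions are bound variables of the statement, so \<open>\<real>\<^sup>n\<close> is the carrier of the library's
  \<^const>\<open>Euclidean_space\<close> \<open>n\<close>: functions \<open>nat \<Rightarrow> real\<close> that vanish at all indices \<open>\<ge> n\<close>.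
  Coordinates are numbered from 0.
\<close>

definition l1_norm :: "nat \<Rightarrow> (nat \<Rightarrow> real) \<Rightarrow> real" where
  "l1_norm D x = (\<Sum>j<D. \<bar>x j\<bar>)"

definition cauchy_density :: "real \<Rightarrow> real" where
  "cauchy_density x = 1 / (pi * (1 + x\<^sup>2))"

definition std_cauchy :: "real measure" where
  "std_cauchy = density lborel (\<lambda>x. ennreal (cauchy_density x))"

definition xi :: "real \<Rightarrow> real" where
  "xi l = ln (1 + sqrt l) + 1 / 2 * ln (1 + l)"

definition mu :: "real \<Rightarrow> real" where
  "mu l = (LINT X|std_cauchy. xi (l * \<bar>X\<bar>))"

definition rho :: "nat \<Rightarrow> (nat \<Rightarrow> real) \<Rightarrow> (nat \<Rightarrow> real) \<Rightarrow> real" where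
  "rho k u v = 1 / real k * (\<Sum>i<k. xi \<bar>u i - v i\<bar>)"

text \<open>
  The joint law of a \<open>k \<times> D\<close> matrix with i.i.d. standard Cauchy entries. Stating the probability
  bound for this law, rather than for a matrix on a space of polymorphic type, keeps the constant
  in the statement independent of any type variable.
\<close>

definition cauchy_matrix :: "nat \<Rightarrow> nat \<Rightarrow> (nat \<times> nat \<Rightarrow> real) measure" where
  "cauchy_matrix k D = (\<Pi>\<^sub>M ij\<in>{..<k} \<times> {..<D}. std_cauchy)"

definition linear_map_of ::
  "nat \<Rightarrow> nat \<Rightarrow> (nat \<times> nat \<Rightarrow> real) \<Rightarrow> (nat \<Rightarrow> real) \<Rightarrow> (nat \<Rightarrow> real)" where
  "linear_map_of k D A x = (\<lambda>i. if i < k then \<Sum>j<D. A (i, j) * x j else 0)"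

end

theory Submission
  imports Defs "HOL-Real_Asymp.Real_Asymp"
begin

text \<open>
  By stability of the Cauchy law, each coordinate of \<open>F(x) - F(y)\<close> is distributed as \<open>\<lambda> X\<close> with
  \<open>\<lambda> = \<parallel>x - y\<parallel>\<^sub>1\<close>, so \<open>\<rho>(F(x), F(y))\<close> is an average of \<open>k\<close> independent copies of \<open>Y = \<xi>(\<lambda>\<bar>X\<bar>)\<close>.
  The exponential moments of \<open>Y\<close> are finite only for small exponents, but
  \<open>E (Y\<^sup>2 exp (Y/4)) \<le> \<lambda> (100 + 4/\<pi> max 0 (-ln \<lambda>))\<close> while \<open>\<mu>(\<lambda>)\<close> is at least of order \<open>sqrt \<lambda>\<close>.
  For \<open>\<lambda> \<ge> \<epsilon>\<^sup>2/3\<close> the quotient of the former by \<open>\<mu>\<^sup>2\<close> is at most \<open>2 V\<close> with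
  \<open>V = 400 + 8/\<pi> (1 - ln (\<epsilon>\<^sup>2/3))\<close>, so a Chernoff bound gives each tail probability at most
  \<open>exp (-k \<epsilon>\<^sup>2/(4 V)) \<le> N\<^bsup>-(c+2)\<^esup>\<close>; a union bound over the \<open>N (N - 1)/2\<close> unordered pairs concludes.
\<close>

section \<open>Convolution of Cauchy densities\<close>

text \<open>Integrability is a consequence here: the antiderivative of a nonnegative function has
  two finite limits, so the fundamental theorem on the extended real line yields it together with
  the value.\<close>

lemma nn_integral_FTC_real_line:
  fixes f F :: "real \<Rightarrow> real"
  assumes F: "\<And>x. DERIV F x :> f x" and f: "continuous_on UNIV f" and nonneg: "\<And>x. 0 \<le> f x"
    and bot: "(F \<longlongrightarrow> l) at_bot" and top: "(F \<longlongrightarrow> u) at_top"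
  shows "(\<integral>\<^sup>+x. ennreal (f x) \<partial>lborel) = ennreal (u - l)"
proof -
  have A: "((F \<circ> real_of_ereal) \<longlongrightarrow> l) (at_right (-\<infinity>))"
    using bot by (simp add: ereal_tendsto_simps)
  have B: "((F \<circ> real_of_ereal) \<longlongrightarrow> u) (at_left \<infinity>)"
    using top by (simp add: ereal_tendsto_simps)
  have cont: "\<And>x. isCont f x"
    using f by (simp add: continuous_on_eq_continuous_at)
  note FTC = interval_integral_FTC_nonneg[of "-\<infinity>" \<infinity> F f, OF _ F cont _ A B]
  have "integrable lborel f"
    using FTC(1) nonneg by (simp add: set_integrable_def)
  moreover have "integral\<^sup>L lborel f = u - l"
    using FTC(2) nonneg by (simp add: interval_lebesgue_integral_def set_lebesgue_integral_def)
  ultimately show ?thesis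
    using nonneg by (subst nn_integral_eq_integral) auto
qed

text \<open>Density of the Cauchy law of scale \<open>a\<close>. At \<open>a = 0\<close> the formula
  degenerates to the zero function, so the point mass has to be treated apart from it.\<close>

definition cauchy_pdf :: "real \<Rightarrow> real \<Rightarrow> real" where
  "cauchy_pdf a x = a / (pi * (x\<^sup>2 + a\<^sup>2))"

lemma cauchy_pdf_nonneg: "0 \<le> a \<Longrightarrow> 0 \<le> cauchy_pdf a x"
  by (simp add: cauchy_pdf_def)

lemma borel_measurable_cauchy_pdf[measurable]: "cauchy_pdf a \<in> borel_measurable borel"
  unfolding cauchy_pdf_def by measurable

text \<open>Partial fractions give an explicit antiderivative. Assumption \<open>D\<close> fails
  only for \<open>z = 0\<close> and \<open>a = b\<close>, when the two quadratics coincide and the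
  decomposition breaks down.\<close>

lemma nn_integral_cauchy_kernels:
  fixes a b z :: real
  assumes a: "0 < a" and b: "0 < b" and D: "z\<^sup>2 + (a - b)\<^sup>2 \<noteq> 0"
  shows "(\<integral>\<^sup>+x. ennreal (1 / ((x\<^sup>2 + a\<^sup>2) * ((z - x)\<^sup>2 + b\<^sup>2))) \<partial>lborel)
    = ennreal (pi * (a + b) / (a * b * (z\<^sup>2 + (a + b)\<^sup>2)))"
proof -
  \<comment> \<open>\<open>d\<close> is the resultant of \<open>x\<^sup>2 + a\<^sup>2\<close> and
    \<open>(x - z)\<^sup>2 + b\<^sup>2\<close>, the common denominator of the partial fraction
    coefficients.\<close>
  define d where "d = (z\<^sup>2 + (a - b)\<^sup>2) * (z\<^sup>2 + (a + b)\<^sup>2)"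
  have pos1: "0 < z\<^sup>2 + (a + b)\<^sup>2"
    using a b by (intro add_nonneg_pos) auto
  have d0: "d \<noteq> 0" using D pos1 by (metis d_def less_irrefl mult_eq_0_iff)
  \<comment> \<open>The numerators will be \<open>p * x + q\<close> and
    \<open>r - p * (x - z)\<close>: the leading coefficients are opposite because the cubic terms
    over the common denominator must cancel.\<close>
  define p q r where "p = 2 * z / d" and "q = (z\<^sup>2 + b\<^sup>2 - a\<^sup>2) / d" and "r = (z\<^sup>2 + a\<^sup>2 - b\<^sup>2) / d"
  define f where "f = (\<lambda>x. 1 / ((x\<^sup>2 + a\<^sup>2) * ((z - x)\<^sup>2 + b\<^sup>2)))"
  \<comment> \<open>The opposite leading coefficients merge two divergent logarithms into one whose
    argument tends to 1, so only the arctangents contribute to the integral.\<close>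
  define L where "L = (\<lambda>x. ln ((x\<^sup>2 + a\<^sup>2) / ((x - z)\<^sup>2 + b\<^sup>2)))"
  define F where "F = (\<lambda>x. p / 2 * L x + q / a * arctan (x / a) + r / b * arctan ((x - z) / b))"
  have P: "0 < x\<^sup>2 + a\<^sup>2" "0 < (x - z)\<^sup>2 + b\<^sup>2" for x
    using a b by (auto intro!: add_nonneg_pos)
  have split: "(p * x + q) / (x\<^sup>2 + a\<^sup>2) + (r - p * (x - z)) / ((x - z)\<^sup>2 + b\<^sup>2) = f x" for x
  proof -
    have "(2 * z * x + (z\<^sup>2 + b\<^sup>2 - a\<^sup>2)) * ((x - z)\<^sup>2 + b\<^sup>2)
        + ((z\<^sup>2 + a\<^sup>2 - b\<^sup>2) - 2 * z * (x - z)) * (x\<^sup>2 + a\<^sup>2) = d"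
      unfolding d_def by (simp add: power2_eq_square algebra_simps)
    moreover have pq: "p * x + q = (2 * z * x + (z\<^sup>2 + b\<^sup>2 - a\<^sup>2)) / d"
      and rp: "r - p * (x - z) = ((z\<^sup>2 + a\<^sup>2 - b\<^sup>2) - 2 * z * (x - z)) / d"
      by (simp_all add: p_def q_def r_def add_divide_distrib diff_divide_distrib)
    ultimately have "(p * x + q) * ((x - z)\<^sup>2 + b\<^sup>2) + (r - p * (x - z)) * (x\<^sup>2 + a\<^sup>2) = 1"
      using d0 by (simp add: pq rp add_divide_distrib[symmetric])
    thus ?thesis
      using P[of x, THEN less_imp_neq] unfolding f_def
      by (subst add_frac_eq) (auto simp only: power2_commute[of z x])
  qed
  have arct: "((\<lambda>x. arctan ((x - u) / c)) has_real_derivative c / ((x - u)\<^sup>2 + c\<^sup>2)) (at x)"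
    if "0 < c" for u c x :: real
    using that by (auto intro!: derivative_eq_intros simp: field_simps power2_eq_square)
  have logd: "(L has_real_derivative 2 * x / (x\<^sup>2 + a\<^sup>2) - 2 * (x - z) / ((x - z)\<^sup>2 + b\<^sup>2)) (at x)" for x
  proof -
    have "L = (\<lambda>x. ln (x\<^sup>2 + a\<^sup>2) - ln ((x - z)\<^sup>2 + b\<^sup>2))"
      using P unfolding L_def by (intro ext) (metis ln_divide_pos)
    moreover have "(\<dots> has_real_derivative 2 * x / (x\<^sup>2 + a\<^sup>2) - 2 * (x - z) / ((x - z)\<^sup>2 + b\<^sup>2)) (at x)"
      using P[of x] by (auto intro!: derivative_eq_intros)
    ultimately show ?thesis by simp
  qed
  have deriv: "DERIV F x :> f x" for x
  proof -
    have "DERIV F x :> p / 2 * (2 * x / (x\<^sup>2 + a\<^sup>2) - 2 * (x - z) / ((x - z)\<^sup>2 + b\<^sup>2))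
        + q / a * (a / (x\<^sup>2 + a\<^sup>2)) + r / b * (b / ((x - z)\<^sup>2 + b\<^sup>2))" (is "DERIV F x :> ?f'")
      unfolding F_def using arct[OF a, of 0 x] arct[OF b, of z x]
      by (intro DERIV_add DERIV_cmult logd) auto
    moreover have "?f' = f x"
      unfolding split[symmetric] using a b
      by (simp add: add_divide_distrib diff_divide_distrib right_diff_distrib)
    ultimately show ?thesis by simp
  qed
  have cont: "continuous_on UNIV f"
    unfolding f_def using P by (intro continuous_intros) (metis (no_types) less_irrefl mult_pos_pos power2_commute)
  have nonneg: "0 \<le> f x" for x unfolding f_def by simp
  have Lt: "(L \<longlongrightarrow> 0) at_top" and Lb: "(L \<longlongrightarrow> 0) at_bot"
  proof -
    have "((\<lambda>x. (x\<^sup>2 + a\<^sup>2) / ((x - z)\<^sup>2 + b\<^sup>2)) \<longlongrightarrow> 1) at_top"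
         "((\<lambda>x. (x\<^sup>2 + a\<^sup>2) / ((x - z)\<^sup>2 + b\<^sup>2)) \<longlongrightarrow> 1) at_bot"
      by real_asymp+
    from this[THEN tendsto_ln] show "(L \<longlongrightarrow> 0) at_top" "(L \<longlongrightarrow> 0) at_bot" unfolding L_def by auto
  qed
  have at: "((\<lambda>x. arctan ((x - u) / c)) \<longlongrightarrow> pi / 2) at_top"
    and ab: "((\<lambda>x. arctan ((x - u) / c)) \<longlongrightarrow> - (pi / 2)) at_bot" if "0 < c" for u c :: real
  proof -
    have "filterlim (\<lambda>x. (x - u) / c) at_top at_top" "filterlim (\<lambda>x. (x - u) / c) at_bot at_bot"
      using that by real_asymp+
    thus "((\<lambda>x. arctan ((x - u) / c)) \<longlongrightarrow> pi / 2) at_top" "((\<lambda>x. arctan ((x - u) / c)) \<longlongrightarrow> - (pi / 2)) at_bot"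
      by (auto intro: filterlim_compose[OF tendsto_arctan_at_top] filterlim_compose[OF tendsto_arctan_at_bot])
  qed
  have top: "(F \<longlongrightarrow> p / 2 * 0 + q / a * (pi / 2) + r / b * (pi / 2)) at_top"
    unfolding F_def using at[OF a, of 0] at[OF b, of z] Lt by (intro tendsto_intros) auto
  have bot: "(F \<longlongrightarrow> p / 2 * 0 + q / a * (- (pi / 2)) + r / b * (- (pi / 2))) at_bot"
    unfolding F_def using ab[OF a, of 0] ab[OF b, of z] Lb by (intro tendsto_add tendsto_mult tendsto_const) auto
  \<comment> \<open>The factor containing \<open>a - b\<close> cancels against \<open>d\<close>,
    which leaves the quadratic of scale \<open>a + b\<close>.\<close>
  have "b * (z\<^sup>2 + b\<^sup>2 - a\<^sup>2) + a * (z\<^sup>2 + a\<^sup>2 - b\<^sup>2) = (a + b) * (z\<^sup>2 + (a - b)\<^sup>2)"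
    by (simp add: power2_eq_square algebra_simps)
  hence "b * q + a * r = (a + b) / (z\<^sup>2 + (a + b)\<^sup>2)"
    unfolding q_def r_def using D pos1 by (simp add: d_def add_divide_distrib[symmetric])
  moreover have "pi * q / a + pi * r / b = pi * (b * q + a * r) / (a * b)"
    using a b by (simp add: field_simps)
  ultimately have "pi * q / a + pi * r / b = pi * (a + b) / (a * b * (z\<^sup>2 + (a + b)\<^sup>2))"
    by simp
  with nn_integral_FTC_real_line[OF deriv cont nonneg bot top] show ?thesis
    by (simp add: f_def mult.commute)
qed

text \<open>Leaving out the single point \<open>z = 0\<close> avoids the degenerate case of the
  kernel integral; an identity almost everywhere suffices for equality of the measures with these
  densities.\<close>

lemma cauchy_pdf_convolution:
  assumes a: "0 < a" and b: "0 < b"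
  shows "AE z in lborel. (\<integral>\<^sup>+x. ennreal (cauchy_pdf a (z - x)) * ennreal (cauchy_pdf b x) \<partial>lborel)
    = ennreal (cauchy_pdf (a + b) z)"
proof -
  have "(\<integral>\<^sup>+x. ennreal (cauchy_pdf a (z - x)) * ennreal (cauchy_pdf b x) \<partial>lborel)
    = ennreal (cauchy_pdf (a + b) z)" if z: "z \<noteq> 0" for z
  proof -
    have "(\<integral>\<^sup>+x. ennreal (cauchy_pdf a (z - x)) * ennreal (cauchy_pdf b x) \<partial>lborel)
      = (\<integral>\<^sup>+x. ennreal (a * b / pi\<^sup>2) * ennreal (1 / ((x\<^sup>2 + b\<^sup>2) * ((z - x)\<^sup>2 + a\<^sup>2))) \<partial>lborel)"
      using a b by (intro nn_integral_cong)
        (simp add: cauchy_pdf_def ennreal_mult'[symmetric] power2_eq_square mult_ac)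
    also have "\<dots> = ennreal (a * b / pi\<^sup>2) * ennreal (pi * (b + a) / (b * a * (z\<^sup>2 + (b + a)\<^sup>2)))"
      using z by (subst nn_integral_cmult)
        (auto simp: nn_integral_cauchy_kernels[OF b a] sum_power2_eq_zero_iff)
    also have "\<dots> = ennreal (cauchy_pdf (a + b) z)"
    proof -
      have "a * b / pi\<^sup>2 * (pi * (b + a) / (b * a * s)) = (a + b) / (pi * s)" for s
        using a b by (cases "s = 0") (auto simp: field_simps power2_eq_square)
      thus ?thesis
        using a b by (simp add: cauchy_pdf_def ennreal_mult'[symmetric] add.commute)
    qed
    finally show ?thesis .
  qed
  moreover have "AE z in lborel. z \<noteq> (0::real)" by (rule AE_lborel_singleton)
  ultimately show ?thesis by auto
qed

section \<open>Stability of the Cauchy law\<close>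

lemma std_cauchy_eq: "std_cauchy = density lborel (\<lambda>x. ennreal (cauchy_pdf 1 x))"
  by (simp add: std_cauchy_def cauchy_density_def cauchy_pdf_def add.commute)

lemma sets_std_cauchy[simp, measurable_cong]: "sets std_cauchy = sets borel"
  and space_std_cauchy[simp]: "space std_cauchy = UNIV"
  by (simp_all add: std_cauchy_def)

lemma prob_space_std_cauchy: "prob_space std_cauchy"
proof
  have "(arctan has_real_derivative 1 / (x\<^sup>2 + 1)) (at x)" for x :: real
    by (auto intro!: derivative_eq_intros simp: field_simps)
  from DERIV_cdivide[OF this, of pi]
  have "(\<integral>\<^sup>+x. ennreal (1 / (x\<^sup>2 + 1) / pi) \<partial>lborel) = ennreal (pi / 2 / pi - - (pi / 2) / pi)"
  proof (rule nn_integral_FTC_real_line)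
    show "continuous_on UNIV (\<lambda>x::real. 1 / (x\<^sup>2 + 1) / pi)"
      by (auto intro!: continuous_intros simp: add_nonneg_eq_0_iff)
    show "((\<lambda>x. arctan x / pi) \<longlongrightarrow> - (pi / 2) / pi) at_bot"
      by (intro tendsto_divide tendsto_arctan_at_bot tendsto_const) simp
    show "((\<lambda>x. arctan x / pi) \<longlongrightarrow> pi / 2 / pi) at_top"
      by (intro tendsto_divide tendsto_arctan_at_top tendsto_const) simp
  qed auto
  thus "emeasure std_cauchy (space std_cauchy) = 1"
    by (simp add: std_cauchy_eq emeasure_density cauchy_pdf_def mult.commute)
qed

interpretation std_cauchy: prob_space std_cauchy
  by (rule prob_space_std_cauchy)

text \<open>A push-forward rather than a density, so that scale 0 gives the point mass at 0 and
  negative factors make sense: coordinates of \<open>x - y\<close> can be of either kind.\<close>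

definition cauchy_law :: "real \<Rightarrow> real measure" where
  "cauchy_law s = distr std_cauchy borel (\<lambda>x. s * x)"

lemma sets_cauchy_law[simp, measurable_cong]: "sets (cauchy_law s) = sets borel"
  and space_cauchy_law[simp]: "space (cauchy_law s) = UNIV"
  by (simp_all add: cauchy_law_def)

lemma prob_space_cauchy_law: "prob_space (cauchy_law s)"
  unfolding cauchy_law_def by (rule std_cauchy.prob_space_distr) simp

lemma cauchy_law_eq_density:
  assumes "s \<noteq> 0"
  shows "cauchy_law s = density lborel (\<lambda>x. ennreal (cauchy_pdf \<bar>s\<bar> x))"
proof -
  have "distributed std_cauchy lborel (\<lambda>x. x) (\<lambda>x. ennreal (cauchy_pdf 1 x))"
    unfolding distributed_def std_cauchy_eq by (auto simp: distr_id2)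
  with assms have "distributed std_cauchy lborel (\<lambda>x. 0 + s * x) (\<lambda>x. ennreal (cauchy_pdf 1 ((x - 0) / s)) / ennreal \<bar>s\<bar>)"
    by (intro std_cauchy.distributed_affine) auto
  also have "(\<lambda>x. ennreal (cauchy_pdf 1 ((x - 0) / s)) / ennreal \<bar>s\<bar>) = (\<lambda>x. ennreal (cauchy_pdf \<bar>s\<bar> x))"
  proof
    fix x
    have "ennreal (cauchy_pdf 1 ((x - 0) / s)) / ennreal \<bar>s\<bar> = ennreal (cauchy_pdf 1 (x / s) / \<bar>s\<bar>)"
      using assms by (subst divide_ennreal) (auto simp: cauchy_pdf_nonneg)
    also have "cauchy_pdf 1 (x / s) / \<bar>s\<bar> = cauchy_pdf \<bar>s\<bar> x"
    proof -
      define t where "t = \<bar>s\<bar>"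
      have frac: "1 / (pi * (y / (t * t))) / t = t / (pi * y)" if "0 < t" for t y :: real
        using that by (cases "y = 0") (simp_all add: field_simps)
      have t: "0 < t" and sq: "(x / s)\<^sup>2 = x\<^sup>2 / (t * t)"
        using assms by (simp_all add: t_def power_divide power2_eq_square)
      have "(x / s)\<^sup>2 + 1\<^sup>2 = (x\<^sup>2 + t\<^sup>2) / (t * t)"
        unfolding sq using t by (simp add: add_divide_distrib power2_eq_square)
      with frac[OF t, of "x\<^sup>2 + t\<^sup>2"] show ?thesis
        unfolding t_def[symmetric] cauchy_pdf_def by simp
    qed
    finally show "ennreal (cauchy_pdf 1 ((x - 0) / s)) / ennreal \<bar>s\<bar> = ennreal (cauchy_pdf \<bar>s\<bar> x)" .
  qed
  finally show ?thesis
    using distributed_distr_eq_density unfolding cauchy_law_def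
    by (metis (no_types, lifting) add_0 distr_cong sets_lborel ext)
qed

lemma cauchy_law_abs: "cauchy_law \<bar>s\<bar> = cauchy_law s"
  by (cases "s = 0") (simp_all add: cauchy_law_eq_density)

lemma cauchy_law_0: "cauchy_law 0 = return borel 0"
  using std_cauchy.distr_const[of 0 borel] by (simp add: cauchy_law_def)

text \<open>The point mass at 0 is neutral for convolution; this settles the case of a vanishing
  scale, where no density exists.\<close>

lemma convolution_return_0:
  fixes M :: "real measure"
  assumes [measurable_cong, simp]: "sets M = sets borel" and M: "finite_measure M"
  shows "(return borel 0 \<star> M) = M"
proof (rule measure_eqI)
  fix A assume "A \<in> sets (return borel 0 \<star> M)"
  hence [measurable]: "A \<in> sets borel" by simp
  have "finite_measure (return borel (0::real))"
    by (intro prob_space.finite_measure prob_space_return) simp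
  hence "emeasure (return borel 0 \<star> M) A = (\<integral>\<^sup>+x. emeasure M {a. a + x \<in> A} \<partial>return borel 0)"
    using M by (intro convolution_emeasure) (auto simp: sets_eq_imp_space_eq[OF assms(1)])
  also have "\<dots> = emeasure M {a. a + 0 \<in> A}"
  proof (rule nn_integral_return)
    have "(\<lambda>x. emeasure M {a. a + x \<in> A}) = (\<lambda>x. emeasure M (Pair x -` ((\<lambda>(x, a). a + x) -` A)))"
      by (auto simp: vimage_def)
    moreover have "(\<lambda>(x, a). a + x) -` A \<inter> space (borel \<Otimes>\<^sub>M M) \<in> sets (borel \<Otimes>\<^sub>M M)"
      by (rule measurable_sets[where A = borel]) auto
    ultimately show "(\<lambda>x. emeasure M {a. a + x \<in> A}) \<in> borel_measurable borel"
      using finite_measure.sigma_finite_measure[OF M] sets_eq_imp_space_eq[OF assms(1)]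
      by (auto simp: space_pair_measure intro!: sigma_finite_measure.measurable_emeasure_Pair)
  qed simp
  finally show "emeasure (return borel 0 \<star> M) A = emeasure M A" by simp
qed simp

text \<open>Two positive scales are covered by the convolution of densities, and a zero scale by the
  neutral element, moved to the left by commutativity if necessary.\<close>

lemma convolution_cauchy_law:
  assumes a: "0 \<le> a" and b: "0 \<le> b"
  shows "(cauchy_law a \<star> cauchy_law b) = cauchy_law (a + b)"
proof -
  note fin = prob_space.finite_measure[OF prob_space_cauchy_law]
  consider "a = 0" | "b = 0" | "0 < a" "0 < b" using a b by linarith
  thus ?thesis
  proof cases
    case 1
    thus ?thesis by (simp add: cauchy_law_0 convolution_return_0 fin)
  next
    case 2
    have "(cauchy_law a \<star> cauchy_law b) = (cauchy_law b \<star> cauchy_law a)"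
      by (rule convolution_commutative) (simp_all add: fin)
    with 2 show ?thesis by (simp add: cauchy_law_0 convolution_return_0 fin)
  next
    case 3
    have *: "cauchy_law s = density lborel (\<lambda>x. ennreal (cauchy_pdf s x))" if "0 < s" for s
      using cauchy_law_eq_density[of s] that by simp
    have "(cauchy_law a \<star> cauchy_law b)
        = density lborel (\<lambda>z. \<integral>\<^sup>+x. ennreal (cauchy_pdf a (z - x)) * ennreal (cauchy_pdf b x) \<partial>lborel)"
      using 3 fin[of a] fin[of b] unfolding *[OF 3(1)] *[OF 3(2)] by (intro convolution_density) auto
    also have "\<dots> = density lborel (\<lambda>z. ennreal (cauchy_pdf (a + b) z))"
      by (intro density_cong cauchy_pdf_convolution 3) auto
    also have "\<dots> = cauchy_law (a + b)"
      using 3 by (simp add: *)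
    finally show ?thesis .
  qed
qed

lemma (in prob_space) distr_sum_indep_cauchy:
  fixes X :: "'i \<Rightarrow> 'a \<Rightarrow> real"
  assumes "finite I" "indep_vars (\<lambda>_. borel) X I"
    and "\<And>i. i \<in> I \<Longrightarrow> distr M borel (X i) = cauchy_law (b i)" "\<And>i. i \<in> I \<Longrightarrow> 0 \<le> b i"
  shows "distr M borel (\<lambda>\<omega>. \<Sum>i\<in>I. X i \<omega>) = cauchy_law (\<Sum>i\<in>I. b i)"
  using assms
proof (induction I rule: finite_induct)
  case empty
  show ?case by (simp add: cauchy_law_0 distr_const)
next
  case (insert i I)
  have [measurable]: "random_variable borel (X j)" if "j \<in> insert i I" for j
    using insert.prems(1) that by (auto simp: indep_vars_def)
  have "distr M borel (\<lambda>\<omega>. X i \<omega> + (\<Sum>i\<in>I. X i \<omega>))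
      = (distr M borel (X i) \<star> distr M borel (\<lambda>\<omega>. \<Sum>i\<in>I. X i \<omega>))"
    by (intro sum_indep_random_variable indep_vars_sum insert) auto
  also have "distr M borel (\<lambda>\<omega>. \<Sum>i\<in>I. X i \<omega>) = cauchy_law (\<Sum>i\<in>I. b i)"
    using insert.prems by (intro insert.IH indep_vars_subset[OF insert.prems(1)]) auto
  also have "(distr M borel (X i) \<star> \<dots>) = cauchy_law (b i + (\<Sum>i\<in>I. b i))"
    using insert.prems by (simp add: convolution_cauchy_law sum_nonneg)
  finally show ?case using insert.hyps by simp
qed

text \<open>Independence means that the joint law is the product of the marginals, and the joint law
  of all coordinates is the product measure itself.\<close>

lemma indep_vars_PiM_coordinates:
  assumes "I \<noteq> {}" "\<And>i. i \<in> I \<Longrightarrow> prob_space (M i)"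
  shows "prob_space.indep_vars (PiM I M) M (\<lambda>i \<omega>. \<omega> i) I"
proof -
  interpret prob_space "PiM I M" by (intro prob_space_PiM assms)
  have "distr (PiM I M) (PiM I M) (\<lambda>x. \<lambda>i\<in>I. x i) = PiM I M"
    by (subst distr_cong[where g = "\<lambda>x. x" and N = "PiM I M" and L = "PiM I M"])
       (auto simp: space_PiM distr_id2)
  also have "\<dots> = PiM I (\<lambda>i. distr (PiM I M) (M i) (\<lambda>x. x i))"
    by (intro PiM_cong refl) (simp_all add: distr_PiM_component assms)
  finally show ?thesis
    by (subst indep_vars_iff_distr_eq_PiM') (auto simp: assms)
qed

section \<open>Projections by the random matrix\<close>

lemma prob_space_cauchy_matrix: "prob_space (cauchy_matrix k D)"
  unfolding cauchy_matrix_def by (intro prob_space_PiM prob_space_std_cauchy)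

text \<open>Distinct rows use disjoint blocks of entries, hence are independent. Within row
  \<open>i\<close> the summand \<open>A (i, j) * z j\<close> has scale
  \<open>\<bar>z j\<bar>\<close>, and by stability the scales add up to the 1-norm.\<close>

lemma
  assumes "0 < k" "0 < D"
  shows indep_vars_cauchy_projections:
      "prob_space.indep_vars (cauchy_matrix k D) (\<lambda>_. borel) (\<lambda>i A. \<Sum>j<D. A (i, j) * z j) {..<k}"
    and distr_cauchy_projection:
      "i < k \<Longrightarrow> distr (cauchy_matrix k D) borel (\<lambda>A. \<Sum>j<D. A (i, j) * z j) = cauchy_law (l1_norm D z)"
proof -
  interpret prob_space "cauchy_matrix k D" by (rule prob_space_cauchy_matrix)
  let ?I = "{..<k} \<times> {..<D}"
  let ?K = "\<lambda>i::nat. {i} \<times> {..<D}"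
  let ?X = "\<lambda>(p::nat \<times> nat) A. A p * z (snd p) :: real"
  have "indep_vars (\<lambda>_. std_cauchy) (\<lambda>p A. A p) ?I"
    unfolding cauchy_matrix_def using assms
    by (intro indep_vars_PiM_coordinates prob_space_std_cauchy) auto
  hence indep: "indep_vars (\<lambda>_. borel) ?X ?I"
    by (rule indep_vars_compose2) auto
  have row: "(\<Sum>p\<in>?K i. f p) = (\<Sum>j<D. f (i, j))" for i and f :: "nat \<times> nat \<Rightarrow> real"
    using sum.cartesian_product[of "\<lambda>i j. f (i, j)" "{..<D}" "{i}"] by simp
  have "indep_vars (\<lambda>i. PiM (?K i) (\<lambda>_. borel)) (\<lambda>i A. restrict (\<lambda>p. ?X p A) (?K i)) {..<k}"
    by (rule indep_vars_restrict[OF indep]) (auto simp: disjoint_family_on_def)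
  hence "indep_vars (\<lambda>_. borel) (\<lambda>i A. \<Sum>p\<in>?K i. restrict (\<lambda>p. ?X p A) (?K i) p) {..<k}"
    by (rule indep_vars_compose2) auto
  also have "(\<lambda>i A. \<Sum>p\<in>?K i. restrict (\<lambda>p. ?X p A) (?K i) p) = (\<lambda>i A. \<Sum>j<D. A (i, j) * z j)"
    by (simp add: row)
  finally show "indep_vars (\<lambda>_. borel) (\<lambda>i A. \<Sum>j<D. A (i, j) * z j) {..<k}" .
  assume i: "i < k"
  \<comment> \<open>Symmetry of the law replaces the factor by its absolute value, since only
    nonnegative scales may be added.\<close>
  have "distr (cauchy_matrix k D) borel (?X p) = cauchy_law \<bar>z (snd p)\<bar>" if p: "p \<in> ?I" for p
  proof -
    have [measurable]: "(\<lambda>A. A p) \<in> measurable (cauchy_matrix k D) std_cauchy"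
      unfolding cauchy_matrix_def using p by measurable
    have "cauchy_law \<bar>z (snd p)\<bar> = distr (distr (cauchy_matrix k D) std_cauchy (\<lambda>A. A p)) borel (\<lambda>x. z (snd p) * x)"
      unfolding cauchy_law_abs unfolding cauchy_law_def cauchy_matrix_def using p
      by (subst distr_PiM_component) (auto simp: prob_space_std_cauchy)
    also have "\<dots> = distr (cauchy_matrix k D) borel (?X p)"
      by (subst distr_distr) (auto simp: o_def mult.commute)
    finally show ?thesis ..
  qed
  hence "distr (cauchy_matrix k D) borel (\<lambda>A. \<Sum>p\<in>?K i. ?X p A) = cauchy_law (\<Sum>p\<in>?K i. \<bar>z (snd p)\<bar>)"
    using i by (intro distr_sum_indep_cauchy indep_vars_subset[OF indep]) auto
  thus "distr (cauchy_matrix k D) borel (\<lambda>A. \<Sum>j<D. A (i, j) * z j) = cauchy_law (l1_norm D z)"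
    by (simp add: row l1_norm_def)
qed

section \<open>Moments of \<open>\<xi>\<close> under the Cauchy law\<close>

text \<open>The integrand is even, so reflection doubles the integral over the positive half-line.
  The reflected half-line misses only the null set at 0.\<close>

lemma nn_integral_std_cauchy_abs:
  assumes [measurable]: "g \<in> borel_measurable borel"
  shows "(\<integral>\<^sup>+x. g \<bar>x\<bar> \<partial>std_cauchy)
    = (\<integral>\<^sup>+x. ennreal (2 / (pi * (1 + x\<^sup>2))) * g x * indicator {0..} x \<partial>lborel)"
proof -
  define h where "h = (\<lambda>x. ennreal (cauchy_density x) * g \<bar>x\<bar>)"
  have [measurable]: "cauchy_density \<in> borel_measurable borel"
    unfolding cauchy_density_def by measurable
  have [measurable]: "h \<in> borel_measurable borel" unfolding h_def by measurable
  have "(\<integral>\<^sup>+x. g \<bar>x\<bar> \<partial>std_cauchy) = (\<integral>\<^sup>+x. h x \<partial>lborel)"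
    unfolding std_cauchy_def h_def by (subst nn_integral_density) auto
  also have "\<dots> = (\<integral>\<^sup>+x. h x * indicator {0..} x + h x * indicator {..<0} x \<partial>lborel)"
    by (intro nn_integral_cong) (auto split: split_indicator)
  also have "\<dots> = (\<integral>\<^sup>+x. h x * indicator {0..} x \<partial>lborel) + (\<integral>\<^sup>+x. h x * indicator {..<0} x \<partial>lborel)"
    by (rule nn_integral_add) auto
  also have "(\<integral>\<^sup>+x. h x * indicator {..<0} x \<partial>lborel)
      = (\<integral>\<^sup>+x. h (0 + -1 * x) * indicator {..<0} (0 + -1 * x) \<partial>lborel)"
    by (subst nn_integral_real_affine[where c = "-1" and t = 0]) auto
  also have "\<dots> = (\<integral>\<^sup>+x. h x * indicator {0..} x \<partial>lborel)"
  proof (rule nn_integral_cong_AE)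
    have "AE x in lborel. x \<noteq> (0::real)" by (rule AE_lborel_singleton)
    thus "AE x in lborel. h (0 + -1 * x) * indicator {..<0} (0 + -1 * x) = h x * indicator {0..} x"
      by eventually_elim (auto simp: h_def cauchy_density_def split: split_indicator)
  qed
  also have "(\<integral>\<^sup>+x. h x * indicator {0..} x \<partial>lborel) + (\<integral>\<^sup>+x. h x * indicator {0..} x \<partial>lborel)
      = (\<integral>\<^sup>+x. h x * indicator {0..} x + h x * indicator {0..} x \<partial>lborel)"
    by (rule nn_integral_add[symmetric]) auto
  also have "\<dots> = (\<integral>\<^sup>+x. ennreal (2 / (pi * (1 + x\<^sup>2))) * g x * indicator {0..} x \<partial>lborel)"
  proof (intro nn_integral_cong)
    fix x :: real
    have "ennreal (2 / (pi * (1 + x\<^sup>2))) = ennreal (cauchy_density x) + ennreal (cauchy_density x)"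
      by (simp add: cauchy_density_def ennreal_plus[symmetric] del: ennreal_plus)
    thus "h x * indicator {0..} x + h x * indicator {0..} x
        = ennreal (2 / (pi * (1 + x\<^sup>2))) * g x * indicator {0..} x"
      by (auto simp: h_def distrib_right split: split_indicator)
  qed
  finally show ?thesis .
qed

text \<open>The median of \<open>\<bar>X\<bar>\<close> is 1 because \<open>arctan 1\<close> is
  \<open>pi / 4\<close>. This turns values of \<open>xi\<close> into lower bounds for
  \<open>mu\<close>.\<close>

lemma prob_std_cauchy_ge_1: "measure std_cauchy {x. 1 \<le> \<bar>x\<bar>} = 1 / 2"
proof -
  have "emeasure std_cauchy {x. 1 \<le> \<bar>x\<bar>} = (\<integral>\<^sup>+x. indicator {x. 1 \<le> \<bar>x\<bar>} x \<partial>std_cauchy)"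
    by simp
  also have "\<dots> = (\<integral>\<^sup>+x. indicator {1..} \<bar>x\<bar> \<partial>std_cauchy)"
    by (intro nn_integral_cong) (auto split: split_indicator)
  also have "\<dots> = (\<integral>\<^sup>+x. ennreal (2 / (pi * (1 + x\<^sup>2))) * indicator {1..} x \<partial>lborel)"
    by (subst nn_integral_std_cauchy_abs) (auto intro!: nn_integral_cong split: split_indicator)
  also have "\<dots> = ennreal (2 / pi * (pi / 2) - 2 / pi * arctan 1)"
  proof (rule nn_integral_FTC_atLeast)
    show "((\<lambda>x. 2 / pi * arctan x) has_real_derivative 2 / (pi * (1 + x\<^sup>2))) (at x)" for x
      using DERIV_cmult[OF DERIV_arctan, of "2 / pi" x] by (simp add: divide_inverse mult.assoc)
    show "((\<lambda>x. 2 / pi * arctan x) \<longlongrightarrow> 2 / pi * (pi / 2)) at_top"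
      by (intro tendsto_mult tendsto_const tendsto_arctan_at_top)
  qed auto
  also have "\<dots> = ennreal (1 / 2)" by (simp add: arctan_one)
  finally show ?thesis unfolding measure_def by (metis enn2real_ennreal divide_nonneg_nonneg zero_le_numeral zero_le_one)
qed

section \<open>Pointwise bounds on \<open>xi\<close> and its weighted square\<close>

lemma xi_nonneg: "0 \<le> l \<Longrightarrow> 0 \<le> xi l"
  by (simp add: xi_def)

lemma xi_mono: "0 \<le> a \<Longrightarrow> a \<le> b \<Longrightarrow> xi a \<le> xi b"
  unfolding xi_def by (intro add_mono mult_left_mono) (auto simp: add_pos_nonneg)

lemma borel_measurable_xi[measurable]: "xi \<in> borel_measurable borel"
  unfolding xi_def by measurable

lemma xi_le: "0 \<le> a \<Longrightarrow> xi a \<le> sqrt a + a / 2"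
  using ln_add_one_self_le_self[of "sqrt a"] ln_add_one_self_le_self[of a] by (simp add: xi_def)

lemma exp_xi: "0 \<le> a \<Longrightarrow> exp (xi a) = (1 + sqrt a) * sqrt (1 + a)"
  by (simp add: xi_def exp_add add_pos_nonneg ln_sqrt[symmetric])

text \<open>In the variable \<open>t = sqrt l\<close> the difference of the two sides vanishes at 0,
  and its derivative has the sign of \<open>1 - t\<close>; hence the restriction to
  \<open>l \<le> 1\<close>.\<close>

lemma sqrt_le_xi:
  assumes "0 \<le> l" "l \<le> 1"
  shows "sqrt l \<le> xi l"
proof -
  define h where "h = (\<lambda>t::real. ln (1 + t) + 1 / 2 * ln (1 + t\<^sup>2) - t)"
  have "h 0 \<le> h (sqrt l)"
  proof (rule DERIV_nonneg_imp_nondecreasing[of 0 "sqrt l" h])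
    fix t assume t: "0 \<le> t" "t \<le> sqrt l"
    have t1: "t \<le> 1" using t(2) assms real_sqrt_le_1_iff[of l] by linarith
    have pos: "0 < 1 + t" "0 < 1 + t\<^sup>2" using t(1) by (auto simp: add_pos_nonneg)
    have "(h has_real_derivative 1 / (1 + t) + t / (1 + t\<^sup>2) - 1) (at t)"
      unfolding h_def using pos by (auto intro!: derivative_eq_intros simp: divide_simps)
    moreover have "1 / (1 + t) + t / (1 + t\<^sup>2) - 1 = t\<^sup>2 * (1 - t) / ((1 + t) * (1 + t\<^sup>2))"
      using pos by (simp add: divide_simps) (simp add: power2_eq_square algebra_simps)
    moreover have "0 \<le> t\<^sup>2 * (1 - t) / ((1 + t) * (1 + t\<^sup>2))"
      using t1 pos by simp
    ultimately show "\<exists>y. (h has_real_derivative y) (at t) \<and> 0 \<le> y" by auto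
  qed (use assms in simp_all)
  thus ?thesis using assms by (simp add: h_def xi_def)
qed

text \<open>For \<open>0 \<le> a\<close> and \<open>\<bar>r\<bar> \<le> 1 / 4\<close>,
  \<open>r\<^sup>2 / 2\<close> times this dominates the quadratic remainder of
  \<open>exp (r * xi a)\<close>. The exponent 1/4 is small enough for the weight to be integrable
  under the Cauchy law.\<close>

definition xi_weight :: "real \<Rightarrow> real" where
  "xi_weight a = (xi a)\<^sup>2 * exp (xi a / 4)"

lemma xi_weight_nonneg: "0 \<le> xi_weight a"
  by (simp add: xi_weight_def)

lemma borel_measurable_xi_weight[measurable]: "xi_weight \<in> borel_measurable borel"
  unfolding xi_weight_def by measurable

text \<open>The linear coefficient 2 matters: integrated against the density it yields the logarithm
  with factor \<open>4 / pi\<close>, which becomes \<open>8 / pi\<close> in the formula for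
  \<open>k\<close>.\<close>

lemma xi_weight_le_small:
  assumes a: "0 \<le> a" "a \<le> 1"
  shows "xi_weight a \<le> 2 * a + 4 * a\<^sup>2"
proof -
  define t where "t = sqrt a"
  have t: "0 \<le> t" "t \<le> 1" "a = t\<^sup>2" using a by (auto simp: t_def)
  have X: "xi a \<le> t + t\<^sup>2 / 2" "0 \<le> xi a"
    using xi_le[OF a(1)] xi_nonneg[OF a(1)] t(3) unfolding t_def[symmetric] by simp_all
  have "(xi a)\<^sup>2 \<le> (t + t\<^sup>2 / 2)\<^sup>2"
    using X by (intro power_mono) auto
  \<comment> \<open>The number 9/8 is chosen to give 2 when multiplied by the later bound 16/9 for
    the exponential. The two sides then differ by \<open>t\<^sup>2\<close> times twice a
    square.\<close>
  also have "\<dots> \<le> 9 / 8 * t\<^sup>2 + 9 / 4 * (t\<^sup>2)\<^sup>2"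
  proof -
    have "9 / 8 * t\<^sup>2 + 9 / 4 * (t\<^sup>2)\<^sup>2 - (t + t\<^sup>2 / 2)\<^sup>2 = t\<^sup>2 * (1 / 8 + 2 * t\<^sup>2 - t)"
      by (simp add: power2_eq_square algebra_simps)
    also have "1 / 8 + 2 * t\<^sup>2 - t = 2 * (t - 1 / 4)\<^sup>2"
      by (simp add: power2_eq_square algebra_simps)
    finally have "9 / 8 * t\<^sup>2 + 9 / 4 * (t\<^sup>2)\<^sup>2 - (t + t\<^sup>2 / 2)\<^sup>2 = t\<^sup>2 * (2 * (t - 1 / 4)\<^sup>2)" .
    moreover have "0 \<le> t\<^sup>2 * (2 * (t - 1 / 4)\<^sup>2)" by simp
    ultimately show ?thesis by linarith
  qed
  finally have A: "(xi a)\<^sup>2 \<le> 9 / 8 * a + 9 / 4 * a\<^sup>2" by (simp add: t)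
  have "t\<^sup>2 \<le> 1" using t(1,2) by (simp add: power_le_one)
  hence "xi a / 4 \<le> 3 / 8" using X t by linarith
  hence "exp (xi a / 4) \<le> exp (3 / 8)" by simp
  also have "\<dots> \<le> 1 + 3 / 8 + (3 / 8)\<^sup>2" by (rule exp_bound) auto
  also have "\<dots> \<le> 16 / 9" by (simp add: power2_eq_square)
  finally have B: "exp (xi a / 4) \<le> 16 / 9" .
  have "xi_weight a \<le> (9 / 8 * a + 9 / 4 * a\<^sup>2) * (16 / 9)"
    unfolding xi_weight_def using A B a by (intro mult_mono) auto
  thus ?thesis by (simp add: algebra_simps)
qed

text \<open>The square is absorbed by a second factor \<open>exp (xi a / 4)\<close>, which leaves
  \<open>exp (xi a / 2)\<close>. As \<open>exp (xi a) \<le> 4 * a\<close> here, the growth is of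
  order \<open>sqrt a\<close>, integrable against a tail of order
  \<open>1 / x\<^sup>2\<close>.\<close>

lemma xi_weight_le_large:
  assumes a: "1 \<le> a"
  shows "xi_weight a \<le> 64 * sqrt a"
proof -
  define y where "y = xi a"
  have y: "0 \<le> y" using a by (simp add: y_def xi_nonneg)
  have "y / 4 * (y / 4) / 2 \<le> exp (y / 4)"
    using exp_lower_Taylor_quadratic[of "y / 4"] y by (simp add: power2_eq_square)
  hence "y\<^sup>2 * exp (y / 4) \<le> 32 * exp (y / 4) * exp (y / 4)"
    by (intro mult_right_mono) (auto simp: power2_eq_square)
  also have "\<dots> = 32 * sqrt (exp y)"
  proof -
    have "sqrt (exp y) = exp (y / 2)"
      by (rule real_sqrt_unique) (simp_all add: exp_double[symmetric])
    thus ?thesis by (simp add: mult.assoc exp_add[symmetric])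
  qed
  also have "sqrt (exp y) \<le> sqrt (4 * a)"
  proof (rule real_sqrt_le_mono)
    have "exp y = (1 + sqrt a) * sqrt (1 + a)" unfolding y_def using a by (simp add: exp_xi)
    also have "\<dots> \<le> (2 * sqrt a) * sqrt (4 * a)"
      using a by (intro mult_mono real_sqrt_le_mono) auto
    also have "\<dots> = 4 * a" using a by (simp add: real_sqrt_mult)
    finally show "exp y \<le> 4 * a" .
  qed
  finally show ?thesis by (simp add: xi_weight_def y_def real_sqrt_mult)
qed

text \<open>The integral is split at \<open>x = 1 / l\<close>, where the argument of the weight
  equals 1. Below it the linear and quadratic terms give \<open>A\<close> and \<open>B\<close>,
  above it the square root gives \<open>E\<close>. Only \<open>A\<close> produces a
  logarithm.\<close>

lemma xi_weight_moment:
  assumes l: "0 < l"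
  shows "(\<integral>\<^sup>+x. ennreal (xi_weight (l * \<bar>x\<bar>)) \<partial>std_cauchy)
    \<le> ennreal (l * (100 + 4 / pi * max 0 (- ln l)))"
proof -
  define A where "A = (\<lambda>x. 4 * l / pi * (x / (1 + x\<^sup>2)))"
  define B where "B = (\<lambda>x::real. 8 * l\<^sup>2 / pi)"
  define E where "E = (\<lambda>x. 128 / pi * sqrt l * (1 / (x * sqrt x)))"
  have [measurable]: "A \<in> borel_measurable borel" "B \<in> borel_measurable borel" "E \<in> borel_measurable borel"
    unfolding A_def B_def E_def by measurable
  have nnA: "0 \<le> A x" and nnB: "0 \<le> B x" and nnE: "0 \<le> E x" if "0 \<le> x" for x
    using that l by (auto simp: A_def B_def E_def)
  have small: "2 / (pi * (1 + x\<^sup>2)) * xi_weight (l * x) \<le> A x + B x" if x: "0 \<le> x" "x \<le> 1 / l" for x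
  proof -
    have lx: "0 \<le> l * x" "l * x \<le> 1" using x l by (auto simp: field_simps)
    have pos: "0 < 1 + x\<^sup>2" by (simp add: add_pos_nonneg)
    have "2 / (pi * (1 + x\<^sup>2)) * xi_weight (l * x) \<le> 2 / (pi * (1 + x\<^sup>2)) * (2 * (l * x) + 4 * (l * x)\<^sup>2)"
      using xi_weight_le_small[OF lx] pos by (intro mult_left_mono) auto
    also have "\<dots> = A x + B x * (x\<^sup>2 / (1 + x\<^sup>2))"
      unfolding A_def B_def by (simp add: power_mult_distrib add_divide_distrib distrib_left)
    also have "B x * (x\<^sup>2 / (1 + x\<^sup>2)) \<le> B x * 1"
      using pos nnB[OF x(1)] by (intro mult_left_mono) auto
    finally show ?thesis by simp
  qed
  have large: "2 / (pi * (1 + x\<^sup>2)) * xi_weight (l * x) \<le> E x" if x: "1 / l \<le> x" for x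
  proof -
    have x0: "0 < x" using x l by (meson less_le_trans zero_less_divide_1_iff)
    have lx: "1 \<le> l * x" using x l by (simp add: field_simps)
    have "2 / (pi * (1 + x\<^sup>2)) * xi_weight (l * x) \<le> 2 / (pi * x\<^sup>2) * (64 * sqrt (l * x))"
      using xi_weight_le_large[OF lx] x0 by (intro mult_mono divide_left_mono) (auto simp: add_pos_nonneg xi_weight_nonneg)
    also have "\<dots> = 128 / pi * sqrt l * (sqrt x / (x * x))"
      by (simp add: real_sqrt_mult power2_eq_square)
    also have "sqrt x / (x * x) = 1 / (x * sqrt x)"
      using x0 by (simp add: field_simps)
    finally show ?thesis unfolding E_def .
  qed
  have IA: "(\<integral>\<^sup>+x. ennreal (A x) * indicator {0..1 / l} x \<partial>lborel) = ennreal (2 * l / pi * ln (1 + (1 / l)\<^sup>2))"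
  proof -
    have "(\<integral>\<^sup>+x. ennreal (A x) * indicator {0..1 / l} x \<partial>lborel)
        = ennreal (2 * l / pi * ln (1 + (1 / l)\<^sup>2) - 2 * l / pi * ln (1 + 0\<^sup>2))"
    proof (rule nn_integral_FTC_Icc)
      fix x :: real
      have "0 < 1 + x\<^sup>2" by (simp add: add_pos_nonneg)
      thus "((\<lambda>x. 2 * l / pi * ln (1 + x\<^sup>2)) has_real_derivative A x) (at x)"
        unfolding A_def by (auto intro!: derivative_eq_intros simp: mult_ac)
    qed (use l nnA in auto)
    thus ?thesis by simp
  qed
  have IB: "(\<integral>\<^sup>+x. ennreal (B x) * indicator {0..1 / l} x \<partial>lborel) = ennreal (8 * l / pi)"
    unfolding B_def using l
    by (subst nn_integral_cmult) (auto simp: ennreal_mult'[symmetric] power2_eq_square)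
  have IE: "(\<integral>\<^sup>+x. ennreal (E x) * indicator {1 / l..} x \<partial>lborel) = ennreal (256 * l / pi)"
  proof -
    have [simp]: "sqrt l * sqrt l = l" using l by simp
    have "(\<integral>\<^sup>+x. ennreal (E x) * indicator {1 / l..} x \<partial>lborel)
        = ennreal (0 - - (256 / pi * sqrt l * (1 / sqrt (1 / l))))"
    proof (rule nn_integral_FTC_atLeast)
      fix x assume "1 / l \<le> x"
      hence x: "0 < x" using l by (meson less_le_trans zero_less_divide_1_iff)
      thus "((\<lambda>x. - (256 / pi * sqrt l * (1 / sqrt x))) has_real_derivative E x) (at x)"
        unfolding E_def by (auto intro!: derivative_eq_intros simp: field_simps)
      show "0 \<le> E x" using nnE x by simp
    next
      show "((\<lambda>x. - (256 / pi * sqrt l * (1 / sqrt x))) \<longlongrightarrow> 0) at_top"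
        by real_asymp
    qed auto
    also have "256 / pi * sqrt l * (1 / sqrt (1 / l)) = 256 * l / pi"
      using l by (simp add: real_sqrt_divide)
    finally show ?thesis by simp
  qed
  have "(\<integral>\<^sup>+x. ennreal (xi_weight (l * \<bar>x\<bar>)) \<partial>std_cauchy)
      = (\<integral>\<^sup>+x. ennreal (2 / (pi * (1 + x\<^sup>2))) * ennreal (xi_weight (l * x)) * indicator {0..} x \<partial>lborel)"
    using nn_integral_std_cauchy_abs[of "\<lambda>a. ennreal (xi_weight (l * a))"] by simp
  \<comment> \<open>Both ranges contain the endpoint \<open>1 / l\<close>; the overlap is harmless
    for an upper bound.\<close>
  also have "\<dots> \<le> (\<integral>\<^sup>+x. (ennreal (A x) * indicator {0..1 / l} x + ennreal (B x) * indicator {0..1 / l} x)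
      + ennreal (E x) * indicator {1 / l..} x \<partial>lborel)"
  proof (rule nn_integral_mono)
    fix x :: real
    show "ennreal (2 / (pi * (1 + x\<^sup>2))) * ennreal (xi_weight (l * x)) * indicator {0..} x
      \<le> (ennreal (A x) * indicator {0..1 / l} x + ennreal (B x) * indicator {0..1 / l} x)
        + ennreal (E x) * indicator {1 / l..} x"
    proof (cases "0 \<le> x")
      case x: True
      have eq: "ennreal (2 / (pi * (1 + x\<^sup>2))) * ennreal (xi_weight (l * x)) * indicator {0..} x
          = ennreal (2 / (pi * (1 + x\<^sup>2)) * xi_weight (l * x))"
        using x by (simp add: ennreal_mult'[symmetric] xi_weight_nonneg)
      show ?thesis
      proof (cases "x \<le> 1 / l")
        case True
        hence "ennreal (2 / (pi * (1 + x\<^sup>2)) * xi_weight (l * x)) \<le> ennreal (A x) + ennreal (B x)"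
          using small[OF x True] nnA[OF x] nnB[OF x] by (simp add: ennreal_plus[symmetric] del: ennreal_plus)
        thus ?thesis unfolding eq using x True by (auto intro: order_trans[OF _ le_iff_add[THEN iffD2]])
      next
        case False
        thus ?thesis unfolding eq using large[of x] x by (auto simp: ennreal_leI)
      qed
    qed auto
  qed
  also have "\<dots> = ennreal (2 * l / pi * ln (1 + (1 / l)\<^sup>2)) + ennreal (8 * l / pi) + ennreal (256 * l / pi)"
    unfolding IA[symmetric] IB[symmetric] IE[symmetric] by (subst nn_integral_add, simp, simp)+ simp
  also have "\<dots> = ennreal (l / pi * (2 * ln (1 + (1 / l)\<^sup>2) + 264))"
    using l by (simp add: ennreal_plus[symmetric] field_simps del: ennreal_plus)
  also have "\<dots> \<le> ennreal (l * (100 + 4 / pi * max 0 (- ln l)))"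
  proof (rule ennreal_leI)
    \<comment> \<open>The exponential equals the maximum of 1 and \<open>(1 / l)\<^sup>2\<close>, so
      one formula serves both \<open>l \<le> 1\<close> and \<open>l > 1\<close>.\<close>
    have "1 + (1 / l)\<^sup>2 \<le> 2 * exp (2 * max 0 (- ln l))"
    proof (cases "l \<le> 1")
      case True
      have "exp (2 * max 0 (- ln l)) = (1 / l)\<^sup>2"
        using l True by (simp add: max_def exp_minus exp_double inverse_eq_divide power_divide)
      moreover have "1 \<le> (1 / l)\<^sup>2" using l True by (simp add: one_le_power)
      ultimately show ?thesis by simp
    next
      case False
      hence "(1 / l)\<^sup>2 \<le> 1" using l by (intro power_le_one) auto
      moreover have "1 \<le> exp (2 * max 0 (- ln l))" by simp
      ultimately show ?thesis by linarith
    qed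
    hence "ln (1 + (1 / l)\<^sup>2) \<le> ln (2 * exp (2 * max 0 (- ln l)))"
      by (subst ln_le_cancel_iff) (auto simp: add_pos_nonneg)
    also have "\<dots> = ln 2 + 2 * max 0 (- ln l)" by (simp add: ln_mult)
    also have "ln 2 \<le> (1::real)" using ln_2_less_1 by simp
    \<comment> \<open>With \<open>ln 2 \<le> 1\<close> the constants on the left add up to 266,
      which is below \<open>100 * pi\<close>.\<close>
    finally have "2 * ln (1 + (1 / l)\<^sup>2) + 264 \<le> 100 * pi + 4 * max 0 (- ln l)"
      using pi_gt3 by linarith
    hence "l / pi * (2 * ln (1 + (1 / l)\<^sup>2) + 264) \<le> l / pi * (100 * pi + 4 * max 0 (- ln l))"
      using l by (intro mult_left_mono) auto
    thus "l / pi * (2 * ln (1 + (1 / l)\<^sup>2) + 264) \<le> l * (100 + 4 / pi * max 0 (- ln l))"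
      by (simp add: field_simps)
  qed
  finally show ?thesis .
qed

section \<open>Deviation bounds\<close>

text \<open>Taylor expansion with Lagrange remainder at a point of modulus at most
  \<open>\<bar>z\<bar>\<close>. It holds for either sign of \<open>z\<close>, as the two tails
  require.\<close>

lemma exp_le_quadratic:
  fixes z :: real
  shows "exp z \<le> 1 + z + z\<^sup>2 / 2 * exp \<bar>z\<bar>"
proof -
  obtain t where t: "\<bar>t\<bar> \<le> \<bar>z\<bar>" "exp z = (\<Sum>m<2. z ^ m / fact m) + exp t / fact 2 * z ^ 2"
    using Maclaurin_exp_le[of z 2] by auto
  have "exp t * z\<^sup>2 \<le> exp \<bar>z\<bar> * z\<^sup>2"
    using t(1) by (intro mult_right_mono) auto
  thus ?thesis
    using t(2) by (simp add: numeral_2_eq_2 power2_eq_square mult_ac)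
qed

lemma integrable_xi_weight:
  assumes "0 < l"
  shows "integrable std_cauchy (\<lambda>x. xi_weight (l * \<bar>x\<bar>))"
  using xi_weight_moment[OF assms]
  by (intro integrableI_nonneg) (auto simp: xi_weight_nonneg intro: le_less_trans)

text \<open>A value of \<open>xi\<close> is either at most 1 or at most its own square, so
  \<open>1 + xi_weight\<close> is an integrable majorant.\<close>

lemma integrable_xi:
  assumes "0 < l"
  shows "integrable std_cauchy (\<lambda>x. xi (l * \<bar>x\<bar>))"
proof (rule Bochner_Integration.integrable_bound)
  show "integrable std_cauchy (\<lambda>x. 1 + xi_weight (l * \<bar>x\<bar>))"
    using integrable_xi_weight[OF assms] by auto
  have "xi a \<le> 1 + xi_weight a" if "0 \<le> a" for a
  proof (cases "xi a \<le> 1")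
    case True
    thus ?thesis using xi_weight_nonneg[of a] by linarith
  next
    case False
    have "xi a * 1 \<le> xi a * xi a" using False by (intro mult_left_mono) auto
    also have "\<dots> \<le> (xi a)\<^sup>2 * exp (xi a / 4)"
      using False by (simp add: power2_eq_square mult_le_cancel_left1)
    finally show ?thesis by (simp add: xi_weight_def)
  qed
  thus "AE x in std_cauchy. norm (xi (l * \<bar>x\<bar>)) \<le> norm (1 + xi_weight (l * \<bar>x\<bar>))"
    using assms by (intro AE_I2) (simp add: xi_nonneg xi_weight_nonneg)
qed measurable

text \<open>With probability 1/2 one has \<open>\<bar>X\<bar> \<ge> 1\<close>, and there
  \<open>xi (l * \<bar>X\<bar>)\<close> is at least \<open>xi l\<close> by monotonicity.\<close>

lemma mu_ge:
  assumes l: "0 < l"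
  shows "xi l / 2 \<le> mu l"
proof -
  have "xi l / 2 = (LINT x|std_cauchy. xi l * indicator {x. 1 \<le> \<bar>x\<bar>} x)"
    by (simp add: prob_std_cauchy_ge_1)
  also have "\<dots> \<le> mu l"
    unfolding mu_def
  proof (rule integral_mono)
    show "integrable std_cauchy (\<lambda>x. xi l * indicator {x. 1 \<le> \<bar>x\<bar>} x)"
      by (intro integrable_mult_right integrable_real_indicator) (auto simp: std_cauchy.emeasure_eq_measure)
    fix x :: real
    show "xi l * indicator {x. 1 \<le> \<bar>x\<bar>} x \<le> xi (l * \<bar>x\<bar>)"
      using l by (auto simp: xi_nonneg mult_le_cancel_left1 intro!: xi_mono split: split_indicator)
  qed (rule integrable_xi[OF l])
  finally show ?thesis .
qed

lemma mu_ge_small: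
  assumes "0 < l" "l \<le> 1"
  shows "sqrt l / 2 \<le> mu l"
  using mu_ge[of l] sqrt_le_xi[of l] assms by linarith

text \<open>Above 1 the bound by \<open>sqrt l\<close> is replaced by monotonicity:
  \<open>mu l \<ge> xi 1 / 2 \<ge> 1 / 2\<close>, while \<open>sqrt l \<le> 5 / 4\<close>. The limit
  25/16 is a rational square exceeding \<open>sqrt 2\<close>, hence every admissible
  distance.\<close>

lemma mu_ge_sqrt:
  assumes l: "0 < l" "l \<le> 25 / 16"
  shows "2 / 5 * sqrt l \<le> mu l"
proof (cases "l \<le> 1")
  case True
  have "0 \<le> sqrt l" using l by simp
  thus ?thesis using mu_ge_small[OF l(1) True] by linarith
next
  case False
  have "sqrt l \<le> sqrt ((5 / 4)\<^sup>2)" using l by (intro real_sqrt_le_mono) (simp add: power2_eq_square)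
  also have "\<dots> = 5 / 4" by (rule real_sqrt_unique) auto
  finally have "2 / 5 * sqrt l \<le> 1 / 2" by simp
  also have "\<dots> \<le> xi 1 / 2" using sqrt_le_xi[of 1] by simp
  also have "\<dots> \<le> xi l / 2" using False by (simp add: xi_mono)
  also have "\<dots> \<le> mu l" using l by (intro mu_ge)
  finally show ?thesis .
qed

text \<open>Integrate the quadratic bound for the exponential term by term, then apply
  \<open>1 + u \<le> exp u\<close>.\<close>

lemma xi_mgf_le:
  assumes l: "0 < l" and r: "\<bar>r\<bar> \<le> 1 / 4"
    and m: "(\<integral>\<^sup>+x. ennreal (xi_weight (l * \<bar>x\<bar>)) \<partial>std_cauchy) \<le> ennreal m" "0 \<le> m"
  shows "(\<integral>\<^sup>+x. ennreal (exp (r * xi (l * \<bar>x\<bar>))) \<partial>std_cauchy) \<le> ennreal (exp (r * mu l + r\<^sup>2 / 2 * m))"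
proof -
  let ?Y = "\<lambda>x. xi (l * \<bar>x\<bar>)" and ?W = "\<lambda>x. xi_weight (l * \<bar>x\<bar>)"
  let ?g = "\<lambda>x. 1 + r * ?Y x + r\<^sup>2 / 2 * ?W x"
  note int = integrable_xi[OF l] integrable_xi_weight[OF l]
  have le: "exp (r * ?Y x) \<le> ?g x" for x
  proof -
    have Y: "0 \<le> ?Y x" using l by (simp add: xi_nonneg)
    have "exp \<bar>r * ?Y x\<bar> \<le> exp (?Y x / 4)"
      using mult_right_mono[OF r Y] Y by (simp add: abs_mult)
    hence "(r * ?Y x)\<^sup>2 / 2 * exp \<bar>r * ?Y x\<bar> \<le> (r * ?Y x)\<^sup>2 / 2 * exp (?Y x / 4)"
      by (intro mult_left_mono) auto
    with exp_le_quadratic[of "r * ?Y x"] show ?thesis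
      by (simp add: xi_weight_def power_mult_distrib mult_ac)
  qed
  have g: "0 \<le> ?g x" for x using le[of x] exp_ge_zero[of "r * ?Y x"] by linarith
  have W: "integral\<^sup>L std_cauchy ?W \<le> m"
    using m by (subst integral_eq_nn_integral) (auto simp: xi_weight_nonneg intro: enn2real_leI)
  have "(\<integral>\<^sup>+x. ennreal (exp (r * ?Y x)) \<partial>std_cauchy) \<le> (\<integral>\<^sup>+x. ennreal (?g x) \<partial>std_cauchy)"
    by (intro nn_integral_mono ennreal_leI le)
  also have "\<dots> = ennreal (integral\<^sup>L std_cauchy ?g)"
    using g int by (intro nn_integral_eq_integral) auto
  also have "integral\<^sup>L std_cauchy ?g = 1 + r * mu l + r\<^sup>2 / 2 * integral\<^sup>L std_cauchy ?W"
    using int std_cauchy.prob_space by (simp add: mu_def)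
  also have "\<dots> \<le> 1 + (r * mu l + r\<^sup>2 / 2 * m)"
    using mult_left_mono[OF W, of "r\<^sup>2 / 2"] by simp
  also have "\<dots> \<le> exp (r * mu l + r\<^sup>2 / 2 * m)"
    by (rule exp_ge_add_one_self)
  finally show ?thesis by (simp add: ennreal_leI)
qed

text \<open>Markov's inequality for the product of the exponentials, whose expectation factorises by
  independence. The sign of \<open>r\<close> is left open: positive values give upper tails,
  negative ones lower tails.\<close>

lemma (in prob_space) chernoff_sum:
  fixes Y :: "'i \<Rightarrow> 'a \<Rightarrow> real"
  assumes fin: "finite I" and indep: "indep_vars (\<lambda>_. borel) Y I"
    and mgf: "\<And>i. i \<in> I \<Longrightarrow> (\<integral>\<^sup>+\<omega>. ennreal (exp (r * Y i \<omega>)) \<partial>M) \<le> ennreal (exp c)"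
  shows "prob {\<omega> \<in> space M. t \<le> r * (\<Sum>i\<in>I. Y i \<omega>)} \<le> exp (real (card I) * c - t)"
proof -
  have [measurable]: "Y i \<in> borel_measurable M" if "i \<in> I" for i
    using indep that by (auto simp: indep_vars_def)
  have "emeasure M {\<omega> \<in> space M. t \<le> r * (\<Sum>i\<in>I. Y i \<omega>)}
      = emeasure M {\<omega> \<in> space M. 1 \<le> ennreal (exp (- t)) * (\<Prod>i\<in>I. ennreal (exp (r * Y i \<omega>)))}"
  proof (intro arg_cong[where f = "emeasure M"] Collect_cong conj_cong refl)
    fix \<omega>
    have "ennreal (exp (- t)) * (\<Prod>i\<in>I. ennreal (exp (r * Y i \<omega>))) = ennreal (exp (r * (\<Sum>i\<in>I. Y i \<omega>) - t))"
      using fin by (simp add: prod_ennreal exp_sum[symmetric] sum_distrib_left[symmetric]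
          ennreal_mult'[symmetric] exp_add[symmetric])
    thus "t \<le> r * (\<Sum>i\<in>I. Y i \<omega>)
        \<longleftrightarrow> 1 \<le> ennreal (exp (- t)) * (\<Prod>i\<in>I. ennreal (exp (r * Y i \<omega>)))"
      by (simp add: ennreal_1[symmetric] del: ennreal_1)
  qed
  also have "\<dots> \<le> ennreal (exp (- t)) * (\<integral>\<^sup>+\<omega>. (\<Prod>i\<in>I. ennreal (exp (r * Y i \<omega>))) * indicator (space M) \<omega> \<partial>M)"
    using nn_integral_Markov_inequality[of "\<lambda>\<omega>. \<Prod>i\<in>I. ennreal (exp (r * Y i \<omega>))" "space M" M "ennreal (exp (- t))"]
    by (simp add: Int_def conj_commute)
  also have "(\<integral>\<^sup>+\<omega>. (\<Prod>i\<in>I. ennreal (exp (r * Y i \<omega>))) * indicator (space M) \<omega> \<partial>M)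
      = (\<integral>\<^sup>+\<omega>. (\<Prod>i\<in>I. ennreal (exp (r * Y i \<omega>))) \<partial>M)"
    by (intro nn_integral_cong) auto
  also have "\<dots> = (\<Prod>i\<in>I. \<integral>\<^sup>+\<omega>. ennreal (exp (r * Y i \<omega>)) \<partial>M)"
    by (intro indep_vars_nn_integral fin indep_vars_compose2[OF indep]) auto
  also have "ennreal (exp (- t)) * \<dots> \<le> ennreal (exp (- t)) * (\<Prod>i\<in>I. ennreal (exp c))"
    using mgf by (intro mult_left_mono prod_mono_ennreal) auto
  also have "\<dots> = ennreal (exp (real (card I) * c - t))"
    by (simp add: ennreal_power ennreal_mult'[symmetric] exp_of_nat_mult[symmetric] exp_add[symmetric])
  finally show ?thesis
    by (simp add: emeasure_eq_measure)
qed

text \<open>Transports the scalar estimate along the law of one coordinate. The bound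
  \<open>m\<close> stays free, to be chosen later as a multiple of the squared mean.\<close>

lemma projection_mgf_le:
  assumes k: "0 < k" "0 < D" "i < k" and l: "0 < l1_norm D z" and r: "\<bar>r\<bar> \<le> 1 / 4"
    and m: "(\<integral>\<^sup>+x. ennreal (xi_weight (l1_norm D z * \<bar>x\<bar>)) \<partial>std_cauchy) \<le> ennreal m" "0 \<le> m"
  shows "(\<integral>\<^sup>+A. ennreal (exp (r * xi \<bar>\<Sum>j<D. A (i, j) * z j\<bar>)) \<partial>cauchy_matrix k D)
    \<le> ennreal (exp (r * mu (l1_norm D z) + r\<^sup>2 / 2 * m))"
proof -
  let ?S = "\<lambda>A. \<Sum>j<D. A (i, j) * z j"
  interpret prob_space "cauchy_matrix k D" by (rule prob_space_cauchy_matrix)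
  have [measurable]: "?S \<in> borel_measurable (cauchy_matrix k D)"
    using indep_vars_cauchy_projections[OF k(1,2), of z] k(3) by (auto simp: indep_vars_def)
  have "(\<integral>\<^sup>+A. ennreal (exp (r * xi \<bar>?S A\<bar>)) \<partial>cauchy_matrix k D)
      = (\<integral>\<^sup>+y. ennreal (exp (r * xi \<bar>y\<bar>)) \<partial>distr (cauchy_matrix k D) borel ?S)"
    by (subst nn_integral_distr) auto
  also have "\<dots> = (\<integral>\<^sup>+x. ennreal (exp (r * xi (l1_norm D z * \<bar>x\<bar>))) \<partial>std_cauchy)"
    unfolding distr_cauchy_projection[OF k] cauchy_law_def
    using l by (subst nn_integral_distr) (auto simp: abs_mult)
  also have "\<dots> \<le> ennreal (exp (r * mu (l1_norm D z) + r\<^sup>2 / 2 * m))"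
    by (rule xi_mgf_le[OF l r m])
  finally show ?thesis .
qed

text \<open>
  Both tails are Chernoff bounds at \<open>r = \<plusminus>\<epsilon> / (2 V \<mu>)\<close>, the minimiser of \<open>r\<^sup>2 V \<mu>\<^sup>2 - r \<epsilon> \<mu>\<close>.
  The hypothesis on \<open>V\<close> is what makes \<open>2 V \<mu>\<^sup>2\<close> dominate the weighted second moment.
\<close>

lemma projection_deviation:
  assumes k: "0 < k" and D: "0 < D" and eps: "0 < \<epsilon>" "\<epsilon> < 1"
    and l: "l1_norm D z \<in> {\<epsilon>\<^sup>2 / 3 .. sqrt (1 + \<epsilon>)}"
    and V: "400 + 8 / pi * (1 - ln (\<epsilon>\<^sup>2 / 3)) \<le> V"
  shows "measure (cauchy_matrix k D) {A \<in> space (cauchy_matrix k D).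
      \<not> ((1 - \<epsilon>) * mu (l1_norm D z) \<le> 1 / real k * (\<Sum>i<k. xi \<bar>\<Sum>j<D. A (i, j) * z j\<bar>) \<and>
         1 / real k * (\<Sum>i<k. xi \<bar>\<Sum>j<D. A (i, j) * z j\<bar>) \<le> (1 + \<epsilon>) * mu (l1_norm D z))}
    \<le> 2 * exp (- (real k * \<epsilon>\<^sup>2 / (4 * V)))"
proof -
  define L where "L = l1_norm D z"
  define \<mu> where "\<mu> = mu L"
  define s where "s = \<epsilon> / (2 * V * \<mu>)"
  define Y where "Y = (\<lambda>(i::nat) A. xi \<bar>\<Sum>j<D. A (i, j) * z j\<bar>)"
  interpret prob_space "cauchy_matrix k D" by (rule prob_space_cauchy_matrix)
  let ?M = "cauchy_matrix k D"
  have L: "\<epsilon>\<^sup>2 / 3 \<le> L" "L \<le> sqrt (1 + \<epsilon>)" using l by (auto simp: L_def)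
  have e3: "0 < \<epsilon>\<^sup>2 / 3" using eps by simp
  have L0: "0 < L" using L(1) e3 by linarith
  have "sqrt (1 + \<epsilon>) \<le> sqrt ((25 / 16)\<^sup>2)"
    using eps by (intro real_sqrt_le_mono) (simp add: power2_eq_square)
  also have "\<dots> = 25 / 16" by (rule real_sqrt_unique) auto
  finally have L25: "L \<le> 25 / 16" using L(2) by linarith
  have "\<epsilon>\<^sup>2 \<le> 1" using eps by (simp add: power_le_one)
  hence "ln (\<epsilon>\<^sup>2 / 3) \<le> 0" using e3 by (subst ln_le_zero_iff) auto
  moreover have "ln (\<epsilon>\<^sup>2 / 3) \<le> ln L" using e3 L(1) L0 by simp
  ultimately have "max 0 (- ln L) \<le> 1 - ln (\<epsilon>\<^sup>2 / 3)" by simp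
  hence "8 / pi * max 0 (- ln L) \<le> 8 / pi * (1 - ln (\<epsilon>\<^sup>2 / 3))"
    by (intro mult_left_mono) auto
  with V have VL: "400 + 8 / pi * max 0 (- ln L) \<le> V" by linarith
  hence V400: "400 \<le> V" by (smt (verit) divide_nonneg_pos max.cobounded1 mult_nonneg_nonneg pi_gt_zero)
  have mu25: "2 / 5 * sqrt L \<le> \<mu>" unfolding \<mu>_def using L0 L25 by (rule mu_ge_sqrt)
  hence mu0: "0 < \<mu>" using L0 by (smt (verit) mult_pos_pos real_sqrt_gt_zero zero_less_divide_iff)
  \<comment> \<open>For \<open>L \<le> 1\<close> the bound \<open>\<mu>\<^sup>2 \<ge> L / 4\<close>
    makes the right side at least \<open>L * V / 2\<close>, and halving \<open>8 / pi\<close> in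
    \<open>V\<close> matches the factor \<open>4 / pi\<close> on the left. For \<open>L > 1\<close>
    the logarithmic term vanishes and the weaker bound \<open>4 / 25 * L\<close> suffices, as
    \<open>2 * 400 * 4 / 25 = 128\<close> exceeds 100.\<close>
  have moment: "L * (100 + 4 / pi * max 0 (- ln L)) \<le> 2 * V * \<mu>\<^sup>2"
  proof (cases "L \<le> 1")
    case True
    have "(sqrt L / 2)\<^sup>2 \<le> \<mu>\<^sup>2"
      using mu_ge_small[OF L0 True] L0 by (intro power_mono) (auto simp: \<mu>_def)
    hence "L / 4 \<le> \<mu>\<^sup>2" using L0 by (simp add: power_divide)
    hence "2 * V * (L / 4) \<le> 2 * V * \<mu>\<^sup>2" using V400 by (intro mult_left_mono) auto
    moreover have "L * (100 + 4 / pi * max 0 (- ln L)) \<le> L * (V / 2)"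
      using VL L0 by (intro mult_left_mono) auto
    moreover have "2 * V * (L / 4) = L * (V / 2)" by simp
    ultimately show ?thesis by linarith
  next
    case False
    have "(2 / 5 * sqrt L)\<^sup>2 \<le> \<mu>\<^sup>2" using mu25 L0 by (intro power_mono) auto
    hence "4 / 25 * L \<le> \<mu>\<^sup>2" using L0 by (simp add: power_mult_distrib power_divide)
    hence "2 * V * (4 / 25 * L) \<le> 2 * V * \<mu>\<^sup>2" using V400 by (intro mult_left_mono) auto
    moreover have "L * 100 \<le> L * (V * 8 / 25)" using V400 L0 by (intro mult_left_mono) auto
    moreover have "max 0 (- ln L) = 0" using False by simp
    ultimately show ?thesis by simp
  qed
  have m: "(\<integral>\<^sup>+x. ennreal (xi_weight (l1_norm D z * \<bar>x\<bar>)) \<partial>std_cauchy) \<le> ennreal (2 * V * \<mu>\<^sup>2)"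
    using xi_weight_moment[OF L0] moment unfolding L_def by (meson ennreal_leI order_trans)
  have s0: "0 < s" using eps V400 mu0 by (simp add: s_def)
  \<comment> \<open>The exponent must stay in the range of the moment estimate, that is
    \<open>\<epsilon> \<le> V / 2 * \<mu>\<close>. Since \<open>\<mu>\<close> is of order at least
    \<open>sqrt L\<close>, the lower limit \<open>\<epsilon>\<^sup>2 / 3\<close> on the distance
    ensures this.\<close>
  have "s \<le> 1 / 4"
  proof -
    have "\<epsilon>\<^sup>2 \<le> 4 * L" using L(1) L0 by linarith
    hence "\<epsilon>\<^sup>2 \<le> (2 * sqrt L)\<^sup>2" using L0 by (simp add: power_mult_distrib)
    moreover have "0 \<le> 2 * sqrt L" using L0 by simp
    ultimately have "\<epsilon> \<le> 2 * sqrt L" by (rule power2_le_imp_le)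
    also have "\<dots> \<le> 5 * \<mu>" using mu25 by linarith
    also have "\<dots> \<le> V / 2 * \<mu>" using V400 mu0 by (intro mult_right_mono) auto
    finally show ?thesis using V400 mu0 by (simp add: s_def divide_le_eq mult.commute)
  qed
  hence s4: "\<bar>s\<bar> \<le> 1 / 4" "\<bar>- s\<bar> \<le> 1 / 4" using s0 by auto
  have exponent: "s\<^sup>2 * V * \<mu>\<^sup>2 - s * \<epsilon> * \<mu> = - (\<epsilon>\<^sup>2 / (4 * V))"
  proof -
    have "s\<^sup>2 * V * \<mu>\<^sup>2 - s * \<epsilon> * \<mu> = V * (s * \<mu>)\<^sup>2 - \<epsilon> * (s * \<mu>)"
      by (simp add: power_mult_distrib)
    also have "s * \<mu> = \<epsilon> / (2 * V)" using mu0 by (simp add: s_def)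
    also have "V * (\<epsilon> / (2 * V))\<^sup>2 - \<epsilon> * (\<epsilon> / (2 * V)) = - (\<epsilon>\<^sup>2 / (4 * V))"
      using V400 by (simp add: power2_eq_square divide_simps)
    finally show ?thesis .
  qed
  have indep: "indep_vars (\<lambda>_. borel) Y {..<k}"
    unfolding Y_def by (rule indep_vars_compose2[OF indep_vars_cauchy_projections[OF k D]]) auto
  have tail: "prob {A \<in> space ?M. t \<le> r * (\<Sum>i<k. Y i A)} \<le> exp (real k * (r * \<mu> + r\<^sup>2 / 2 * (2 * V * \<mu>\<^sup>2)) - t)"
    if "\<bar>r\<bar> \<le> 1 / 4" for r t
  proof -
    have "(\<integral>\<^sup>+A. ennreal (exp (r * Y i A)) \<partial>?M) \<le> ennreal (exp (r * \<mu> + r\<^sup>2 / 2 * (2 * V * \<mu>\<^sup>2)))"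
      if "i \<in> {..<k}" for i
      using projection_mgf_le[OF k D _ _ \<open>\<bar>r\<bar> \<le> 1 / 4\<close> m, of i] that L0 V400
      unfolding Y_def L_def[symmetric] \<mu>_def[symmetric] by simp
    from chernoff_sum[OF finite_lessThan indep this, of t] show ?thesis by simp
  qed
  \<comment> \<open>Both tails are put in the form required by \<open>tail\<close>; the factor
    \<open>- s\<close> reverses the inequality of the lower one. Being non-strict, the two events
    cover the strict failures.\<close>
  let ?U = "{A \<in> space ?M. s * (real k * ((1 + \<epsilon>) * \<mu>)) \<le> s * (\<Sum>i<k. Y i A)}"
  let ?L = "{A \<in> space ?M. - s * (real k * ((1 - \<epsilon>) * \<mu>)) \<le> - s * (\<Sum>i<k. Y i A)}"
  have U: "prob ?U \<le> exp (- (real k * \<epsilon>\<^sup>2 / (4 * V)))"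
  proof -
    have "real k * (s * \<mu> + s\<^sup>2 / 2 * (2 * V * \<mu>\<^sup>2)) - s * (real k * ((1 + \<epsilon>) * \<mu>))
        = real k * (s\<^sup>2 * V * \<mu>\<^sup>2 - s * \<epsilon> * \<mu>)" by (simp add: algebra_simps)
    also have "\<dots> = - (real k * \<epsilon>\<^sup>2 / (4 * V))" unfolding exponent by simp
    finally show ?thesis
      using tail[OF s4(1), of "s * (real k * ((1 + \<epsilon>) * \<mu>))"] by (simp only:)
  qed
  have Lo: "prob ?L \<le> exp (- (real k * \<epsilon>\<^sup>2 / (4 * V)))"
  proof -
    have "real k * (- s * \<mu> + (- s)\<^sup>2 / 2 * (2 * V * \<mu>\<^sup>2)) - - s * (real k * ((1 - \<epsilon>) * \<mu>))
        = real k * (s\<^sup>2 * V * \<mu>\<^sup>2 - s * \<epsilon> * \<mu>)" by (simp add: algebra_simps)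
    also have "\<dots> = - (real k * \<epsilon>\<^sup>2 / (4 * V))" unfolding exponent by simp
    finally show ?thesis
      using tail[OF s4(2), of "- s * (real k * ((1 - \<epsilon>) * \<mu>))"] by (simp only:)
  qed
  have [measurable]: "Y i \<in> borel_measurable ?M" if "i \<in> {..<k}" for i
    using indep that by (auto simp: indep_vars_def)
  have "prob {A \<in> space ?M. \<not> ((1 - \<epsilon>) * \<mu> \<le> 1 / real k * (\<Sum>i<k. Y i A) \<and>
         1 / real k * (\<Sum>i<k. Y i A) \<le> (1 + \<epsilon>) * \<mu>)} \<le> prob (?U \<union> ?L)"
  proof (rule finite_measure_mono, rule subsetI)
    fix A
    assume A: "A \<in> {A \<in> space ?M. \<not> ((1 - \<epsilon>) * \<mu> \<le> 1 / real k * (\<Sum>i<k. Y i A) \<and>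
         1 / real k * (\<Sum>i<k. Y i A) \<le> (1 + \<epsilon>) * \<mu>)}"
    define S where "S = (\<Sum>i<k. Y i A)"
    have "S / real k < (1 - \<epsilon>) * \<mu> \<or> (1 + \<epsilon>) * \<mu> < S / real k" using A by (auto simp: S_def)
    hence "S \<le> real k * ((1 - \<epsilon>) * \<mu>) \<or> real k * ((1 + \<epsilon>) * \<mu>) \<le> S"
      using k by (auto simp: pos_divide_less_eq pos_less_divide_eq mult.commute intro: less_imp_le)
    hence "- s * (real k * ((1 - \<epsilon>) * \<mu>)) \<le> - s * S \<or> s * (real k * ((1 + \<epsilon>) * \<mu>)) \<le> s * S"
      using s0 by (auto intro: mult_left_mono)
    thus "A \<in> ?U \<union> ?L" using A unfolding S_def by blast
  next
    show "?U \<union> ?L \<in> events" by measurable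
  qed
  also have "\<dots> \<le> prob ?U + prob ?L" by (rule measure_Un_le) measurable
  also have "\<dots> \<le> 2 * exp (- (real k * \<epsilon>\<^sup>2 / (4 * V)))" using U Lo by simp
  finally show ?thesis unfolding Y_def \<mu>_def L_def .
qed

section \<open>Union bound over pairs of points\<close>

theorem theorem3p0p3:
  shows "\<exists>C>0::real. \<forall>(D::nat) (P::(nat \<Rightarrow> real) set) (N::nat) (\<epsilon>::real) (c::real) (k::nat).
    D \<ge> 1 \<longrightarrow> P \<subseteq> topspace (Euclidean_space D) \<longrightarrow> finite P \<longrightarrow> card P = N \<longrightarrow> N \<ge> 2 \<longrightarrow>
    0 < \<epsilon> \<longrightarrow> \<epsilon> < 1 \<longrightarrow> c > 0 \<longrightarrow>
    k = nat \<lceil>4 * ln (real N powr (c + 2)) / \<epsilon>\<^sup>2 * (C + 8 / pi * (1 - ln (\<epsilon>\<^sup>2 / 3)))\<rceil> \<longrightarrow>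
    measure (cauchy_matrix k D)
      {A \<in> space (cauchy_matrix k D). \<forall>x\<in>P. \<forall>y\<in>P.
        l1_norm D (x - y) \<in> {\<epsilon>\<^sup>2 / 3 .. sqrt (1 + \<epsilon>)} \<longrightarrow>
        (1 - \<epsilon>) * mu (l1_norm D (x - y))
          \<le> rho k (linear_map_of k D A x) (linear_map_of k D A y) \<and>
        rho k (linear_map_of k D A x) (linear_map_of k D A y)
          \<le> (1 + \<epsilon>) * mu (l1_norm D (x - y))}
    \<ge> 1 - real N powr (- c)"
\<comment> \<open>The witness 400 is the constant part of \<open>V\<close> demanded by
  \<open>projection_deviation\<close>.\<close>
proof (intro exI[of _ 400] conjI allI impI)
  fix D :: nat and P :: "(nat \<Rightarrow> real) set" and N :: nat and \<epsilon> c :: real and k :: nat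
  assume D: "D \<ge> 1" and P: "finite P" "card P = N" and N: "N \<ge> 2" and eps: "0 < \<epsilon>" "\<epsilon> < 1" and c: "c > 0"
    and k: "k = nat \<lceil>4 * ln (real N powr (c + 2)) / \<epsilon>\<^sup>2 * (400 + 8 / pi * (1 - ln (\<epsilon>\<^sup>2 / 3)))\<rceil>"
  define V where "V = 400 + 8 / pi * (1 - ln (\<epsilon>\<^sup>2 / 3))"
  define M where "M = cauchy_matrix k D"
  interpret prob_space M unfolding M_def by (rule prob_space_cauchy_matrix)
  have "\<epsilon>\<^sup>2 \<le> 1" using eps by (simp add: power_le_one)
  hence "ln (\<epsilon>\<^sup>2 / 3) \<le> 0" using eps by (subst ln_le_zero_iff) auto
  hence "0 \<le> 8 / pi * (1 - ln (\<epsilon>\<^sup>2 / 3))" by simp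
  hence V: "400 \<le> V" by (simp add: V_def)
  have lnN: "0 < ln (real N powr (c + 2))"
    using N c by (simp add: ln_powr)
  have "0 < 4 * ln (real N powr (c + 2)) / \<epsilon>\<^sup>2 * V"
    using lnN eps V by (intro mult_pos_pos divide_pos_pos) auto
  hence k0: "0 < k" unfolding k V_def[symmetric] by linarith
  have "4 * ln (real N powr (c + 2)) / \<epsilon>\<^sup>2 * V \<le> real k"
    unfolding k V_def[symmetric] by (rule real_nat_ceiling_ge)
  \<comment> \<open>This is what the choice of \<open>k\<close> is for: the Chernoff exponent
    reaches \<open>ln (N powr (c + 2))\<close>.\<close>
  hence "ln (real N powr (c + 2)) \<le> real k * \<epsilon>\<^sup>2 / (4 * V)"
    using eps V by (simp add: field_simps)
  hence "exp (- (real k * \<epsilon>\<^sup>2 / (4 * V))) \<le> exp (- ln (real N powr (c + 2)))" by simp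
  also have "\<dots> = real N powr (- (c + 2))"
    using N by (subst exp_minus, subst exp_ln) (simp_all add: powr_minus[of _ "c + 2"] del: minus_add_distrib)
  finally have tail: "exp (- (real k * \<epsilon>\<^sup>2 / (4 * V))) \<le> real N powr (- (c + 2))" .
  define good where "good = (\<lambda>x y A. l1_norm D (x - y) \<in> {\<epsilon>\<^sup>2 / 3 .. sqrt (1 + \<epsilon>)} \<longrightarrow>
        (1 - \<epsilon>) * mu (l1_norm D (x - y))
          \<le> rho k (linear_map_of k D A x) (linear_map_of k D A y) \<and>
        rho k (linear_map_of k D A x) (linear_map_of k D A y)
          \<le> (1 + \<epsilon>) * mu (l1_norm D (x - y)))"
  have sym: "good x y A = good y x A" for x y A
    by (simp add: good_def l1_norm_def rho_def abs_minus_commute)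
  \<comment> \<open>On the diagonal the distance is 0, below the positive limit
    \<open>\<epsilon>\<^sup>2 / 3\<close>, so the condition is vacuous.\<close>
  have good_refl: "good x x A" for x A
    using eps by (simp add: good_def l1_norm_def)
  have rho_eq: "rho k (linear_map_of k D A x) (linear_map_of k D A y)
      = 1 / real k * (\<Sum>i<k. xi \<bar>\<Sum>j<D. A (i, j) * (x - y) j\<bar>)" for A x y
    by (simp add: rho_def linear_map_of_def sum_subtractf[symmetric] right_diff_distrib)
  have [measurable]: "(\<lambda>A. \<Sum>j<D. A (i, j) * z j) \<in> borel_measurable M" if "i \<in> {..<k}" for i z
    using indep_vars_cauchy_projections[of k D z, folded M_def] k0 D that by (auto simp: indep_vars_def)
  have meas[measurable]: "{A \<in> space M. \<not> good x y A} \<in> events" for x y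
    unfolding good_def rho_eq by measurable
  have bad: "prob {A \<in> space M. \<not> good x y A} \<le> 2 * real N powr (- (c + 2))" for x y
  proof (cases "l1_norm D (x - y) \<in> {\<epsilon>\<^sup>2 / 3 .. sqrt (1 + \<epsilon>)}")
    case True
    have "prob {A \<in> space M. \<not> good x y A} \<le> 2 * exp (- (real k * \<epsilon>\<^sup>2 / (4 * V)))"
      using projection_deviation[OF k0 _ eps True, of V] D True
      by (simp add: good_def rho_eq M_def V_def)
    with tail show ?thesis by linarith
  next
    case False
    hence "{A \<in> space M. \<not> good x y A} = {}" by (auto simp: good_def)
    hence "prob {A \<in> space M. \<not> good x y A} = 0" by (simp only: measure_empty)
    thus ?thesis by simp
  qed
  \<comment> \<open>Unordered pairs are essential for the count: with two tails each, they
    contribute \<open>2 * (N choose 2) \<le> N\<^sup>2\<close>, exactly what the 2 in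
    \<open>c + 2\<close> pays for. Ordered pairs would cost another factor 2.\<close>
  define T where "T = {e. e \<subseteq> P \<and> card e = 2}"
  define E where "E = (\<lambda>e. {A \<in> space M. \<exists>x\<in>e. \<exists>y\<in>e. \<not> good x y A})"
  have T: "finite T" "card T = N choose 2"
    using P n_subsets[OF P(1), of 2] unfolding T_def by auto
  \<comment> \<open>By symmetry and the vacuous diagonal, the four conditions for the pair
    \<open>{x, y}\<close> collapse to a single one.\<close>
  have E_eq: "\<exists>x y. E e = {A \<in> space M. \<not> good x y A}" if eT: "e \<in> T" for e
  proof -
    obtain x y where e: "e = {x, y}" using eT by (auto simp: T_def card_2_iff)
    show ?thesis
      by (intro exI[of _ x] exI[of _ y]) (auto simp: E_def e good_refl sym[of y x])
  qed
  have E_ev: "E e \<in> events" and E_le: "prob (E e) \<le> 2 * real N powr (- (c + 2))" if eT: "e \<in> T" for e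
  proof -
    obtain x y where "E e = {A \<in> space M. \<not> good x y A}" using E_eq[OF eT] by blast
    thus "E e \<in> events" "prob (E e) \<le> 2 * real N powr (- (c + 2))" using meas bad by simp_all
  qed
  have "prob (\<Union>e\<in>T. E e) \<le> (\<Sum>e\<in>T. prob (E e))"
    using E_ev by (intro finite_measure_subadditive_finite T(1)) blast
  also have "\<dots> \<le> (\<Sum>e\<in>T. 2 * real N powr (- (c + 2)))"
    by (rule sum_mono) (rule E_le)
  also have "\<dots> = real (N choose 2) * 2 * real N powr (- (c + 2))" by (simp add: T)
  also have "\<dots> \<le> (real N)\<^sup>2 * real N powr (- (c + 2))"
  proof (intro mult_right_mono)
    have "(N choose 2) * 2 \<le> N * (N - 1)" by (simp only: choose_two div_times_less_eq_dividend)
    also have "\<dots> \<le> N * N" by simp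
    finally have "(N choose 2) * 2 \<le> N * N" .
    thus "real (N choose 2) * 2 \<le> (real N)\<^sup>2"
      unfolding power2_eq_square by (metis of_nat_le_iff of_nat_mult of_nat_numeral)
  qed simp
  also have "\<dots> = real N powr (- c)"
    using N by (simp add: powr_numeral[symmetric] powr_add[symmetric] del: powr_numeral)
  finally have "prob (\<Union>e\<in>T. E e) \<le> real N powr (- c)" .
  moreover have "{A \<in> space M. \<forall>x\<in>P. \<forall>y\<in>P. good x y A} = space M - (\<Union>e\<in>T. E e)"
  proof (intro set_eqI iffI)
    fix A assume A: "A \<in> space M - (\<Union>e\<in>T. E e)"
    have "good x y A" if "x \<in> P" "y \<in> P" for x y
    proof (cases "x = y")
      case False
      hence "{x, y} \<in> T" using that by (simp add: T_def)
      thus ?thesis using A unfolding E_def by blast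
    qed (simp add: good_refl)
    thus "A \<in> {A \<in> space M. \<forall>x\<in>P. \<forall>y\<in>P. good x y A}" using A by auto
  qed (auto simp: E_def T_def)
  moreover have "(\<Union>e\<in>T. E e) \<in> events"
    using E_ev T(1) by (intro sets.finite_UN) auto
  ultimately have "1 - real N powr (- c) \<le> prob {A \<in> space M. \<forall>x\<in>P. \<forall>y\<in>P. good x y A}"
    by (simp add: prob_compl)
  thus "1 - real N powr (- c) \<le> measure (cauchy_matrix k D)
      {A \<in> space (cauchy_matrix k D). \<forall>x\<in>P. \<forall>y\<in>P.
        l1_norm D (x - y) \<in> {\<epsilon>\<^sup>2 / 3 .. sqrt (1 + \<epsilon>)} \<longrightarrow>
        (1 - \<epsilon>) * mu (l1_norm D (x - y))
          \<le> rho k (linear_map_of k D A x) (linear_map_of k D A y) \<and>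
        rho k (linear_map_of k D A x) (linear_map_of k D A y)
          \<le> (1 + \<epsilon>) * mu (l1_norm D (x - y))}"
    unfolding good_def M_def .
qed simp

end
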